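(* Let $(E,\pi,B)$ be a real vector bundle with $n$-dimensional fibres, $g$ a real bundle metric and $L$ a linear transport along paths in it. For each path $\gamma:J\to B$ fix bases $\{e_i(s)\}_{i=1}^n$ of the fibres $\pi^{-1}(\gamma(s))$, $s\in J$, and let $H(t,s;\gamma)$ and $G(\gamma(s))$ be the matrices of $L$ and $g$ in these bases. Then $g$ and $L$ are consistent (resp. consistent along a given path $\gamma$) if and only if $$G(\gamma(s))=H^{T}(t,s;\gamma)\,G(\gamma(t))\,H(t,s;\gamma),\qquad s,t\in J,$$ for every (resp. for the given) path $\gamma:J\to B$.
   Context: A path in $B$ is a (continuous) map $\gamma:J\to B$ with $J$ an arbitrary real interval. A real bundle metric $g$ assigns to each $x\in B$ a bilinear, symmetric, nondegenerate map $g_x:\pi^{-1}(x)\times\pi^{-1}(x)\to\mathbb{R}$ (no regularity in $x$ is needed). A linear transport along paths $L$ assigns to each path $\gamma:J\to B$ and $s,t\in J$ a linear map $L^\gamma_{s\to t}:\pi^{-1}(\gamma(s))\to\pi^{-1}(\gamma(t))$ with $L^\gamma_{t\to r}\circ L^\gamma_{s\to t}=L^\gamma_{s\to r}$ and $L^\gamma_{s\to s}=\mathrm{id}$ for all $r,s,t\in J$. $L$ and $g$ are consistent along $\gamma$ (locally consistent) if $g_{\gamma(s)}(u,v)=g_{\gamma(t)}(L^\gamma_{s\to t}u,L^\gamma_{s\to t}v)$ for all $s,t\in J$ and $u,v\in\pi^{-1}(\gamma(s))$; they are (globally) consistent if this holds along every path. Matrices: $H(t,s;\gamma)=[H^{i}_{\;j}(t,s;\gamma)]$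 is defined by $L^\gamma_{s\to t}e_j(s)=\sum_i H^{i}_{\;j}(t,s;\gamma)e_i(t)$ (upper index = row), and $G(\gamma(s))=[g_{\gamma(s)}(e_i(s),e_j(s))]_{ij}$. $T$ denotes transposition. *)

theory Defs
  imports "HOL-Analysis.Abstract_Euclidean_Space" "Jordan_Normal_Form.VS_Connect"
begin

text \<open>The total space \<open>E\<close> and the base \<open>B\<close> are arbitrary topological spaces. \<open>V x\<close> is the fibre
  over \<open>x\<close> together with its vector space structure over \<open>class_ring\<close>, the field of reals (the
  multiplicative fields \<open>mult\<close> and \<open>one\<close> that the record inherits from rings are irrelevant).
  \<open>Euclidean_space n\<close> consists of the real sequences vanishing from index \<open>n\<close> on.\<close>

locale real_vector_bundle =
  fixes E :: "'e topology" and \<pi> :: "'e \<Rightarrow> 'b" and B :: "'b topology"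
    and V :: "'b \<Rightarrow> (real, 'e) module" and n :: nat
  assumes continuous_proj: "continuous_map E B \<pi>"
    and carrier_fibre: "x \<in> topspace B \<Longrightarrow> carrier (V x) = {u \<in> topspace E. \<pi> u = x}"
    and vectorspace_fibre: "x \<in> topspace B \<Longrightarrow> vectorspace class_ring (V x)"
    and local_triviality: "x \<in> topspace B \<Longrightarrow>
      \<exists>U \<phi>. openin B U \<and> x \<in> U \<and>
        homeomorphic_map (subtopology E {u \<in> topspace E. \<pi> u \<in> U})
          (prod_topology (subtopology B U) (Euclidean_space n)) \<phi> \<and>
        (\<forall>y\<in>U. \<forall>u\<in>carrier (V y). fst (\<phi> u) = y) \<and>
        (\<forall>y\<in>U. \<forall>u\<in>carrier (V y). \<forall>v\<in>carrier (V y).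
          snd (\<phi> (u \<oplus>\<^bsub>V y\<^esub> v)) = (\<lambda>i. snd (\<phi> u) i + snd (\<phi> v) i)) \<and>
        (\<forall>y\<in>U. \<forall>a. \<forall>u\<in>carrier (V y).
          snd (\<phi> (a \<odot>\<^bsub>V y\<^esub> u)) = (\<lambda>i. a * snd (\<phi> u) i))"

text \<open>A path is a map defined on the interval \<open>J\<close> only. Extensionality makes a pair \<open>(J, \<gamma>)\<close>
  determine and be determined by that map, so that objects assigned to paths cannot depend on
  values of \<open>\<gamma>\<close> outside \<open>J\<close>.\<close>

definition path_in :: "'b topology \<Rightarrow> real set \<Rightarrow> (real \<Rightarrow> 'b) \<Rightarrow> bool" where
  "path_in B J \<gamma> \<longleftrightarrow>
    is_interval J \<and> continuous_map (top_of_set J) B \<gamma> \<and> \<gamma> \<in> extensional J"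

definition bundle_metric ::
    "'b topology \<Rightarrow> ('b \<Rightarrow> (real, 'e) module) \<Rightarrow> ('b \<Rightarrow> 'e \<Rightarrow> 'e \<Rightarrow> real) \<Rightarrow> bool" where
  "bundle_metric B V g \<longleftrightarrow> (\<forall>x\<in>topspace B.
    (\<forall>u\<in>carrier (V x). \<forall>v\<in>carrier (V x). \<forall>w\<in>carrier (V x).
      g x (u \<oplus>\<^bsub>V x\<^esub> v) w = g x u w + g x v w \<and>
      g x w (u \<oplus>\<^bsub>V x\<^esub> v) = g x w u + g x w v) \<and>
    (\<forall>a. \<forall>u\<in>carrier (V x). \<forall>v\<in>carrier (V x).
      g x (a \<odot>\<^bsub>V x\<^esub> u) v = a * g x u v \<and> g x u (a \<odot>\<^bsub>V x\<^esub> v) = a * g x u v) \<and>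
    (\<forall>u\<in>carrier (V x). \<forall>v\<in>carrier (V x). g x u v = g x v u) \<and>
    (\<forall>u\<in>carrier (V x). (\<forall>v\<in>carrier (V x). g x u v = 0) \<longrightarrow> u = \<zero>\<^bsub>V x\<^esub>))"

text \<open>\<open>L J \<gamma> s t\<close> is the map of the transport along \<open>\<gamma>\<close>, defined on \<open>J\<close>, from \<open>s\<close> to \<open>t\<close>.\<close>

type_synonym ('e, 'b) transport = "real set \<Rightarrow> (real \<Rightarrow> 'b) \<Rightarrow> real \<Rightarrow> real \<Rightarrow> 'e \<Rightarrow> 'e"

definition linear_transport ::
    "'b topology \<Rightarrow> ('b \<Rightarrow> (real, 'e) module) \<Rightarrow> ('e, 'b) transport \<Rightarrow> bool" where
  "linear_transport B V L \<longleftrightarrow> (\<forall>J \<gamma>. path_in B J \<gamma> \<longrightarrow>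
    (\<forall>s\<in>J. \<forall>t\<in>J. linear_map class_ring (V (\<gamma> s)) (V (\<gamma> t)) (L J \<gamma> s t)) \<and>
    (\<forall>r\<in>J. \<forall>s\<in>J. \<forall>t\<in>J. \<forall>u\<in>carrier (V (\<gamma> s)). L J \<gamma> t r (L J \<gamma> s t u) = L J \<gamma> s r u) \<and>
    (\<forall>s\<in>J. \<forall>u\<in>carrier (V (\<gamma> s)). L J \<gamma> s s u = u))"

definition consistent_along ::
    "('b \<Rightarrow> (real, 'e) module) \<Rightarrow> ('b \<Rightarrow> 'e \<Rightarrow> 'e \<Rightarrow> real) \<Rightarrow> ('e, 'b) transport \<Rightarrow>
      real set \<Rightarrow> (real \<Rightarrow> 'b) \<Rightarrow> bool" where
  "consistent_along V g L J \<gamma> \<longleftrightarrow>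
    (\<forall>s\<in>J. \<forall>t\<in>J. \<forall>u\<in>carrier (V (\<gamma> s)). \<forall>v\<in>carrier (V (\<gamma> s)).
      g (\<gamma> s) u v = g (\<gamma> t) (L J \<gamma> s t u) (L J \<gamma> s t v))"

definition consistent ::
    "'b topology \<Rightarrow> ('b \<Rightarrow> (real, 'e) module) \<Rightarrow> ('b \<Rightarrow> 'e \<Rightarrow> 'e \<Rightarrow> real) \<Rightarrow>
      ('e, 'b) transport \<Rightarrow> bool" where
  "consistent B V g L \<longleftrightarrow> (\<forall>J \<gamma>. path_in B J \<gamma> \<longrightarrow> consistent_along V g L J \<gamma>)"

text \<open>Ordered bases, with indices running from \<open>0\<close> to \<open>n - 1\<close>.\<close>

definition ordered_basis :: "nat \<Rightarrow> (real, 'e) module \<Rightarrow> (nat \<Rightarrow> 'e) \<Rightarrow> bool" where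
  "ordered_basis n W b \<longleftrightarrow> inj_on b {..<n} \<and> vectorspace.basis class_ring W (b ` {..<n})"

text \<open>A choice of a basis \<open>e J \<gamma> s\<close> of the fibre over \<open>\<gamma> s\<close> for each path \<open>\<gamma>\<close> on \<open>J\<close> and each
  \<open>s \<in> J\<close>. It depends on the parameter \<open>s\<close> and not just on the point \<open>\<gamma> s\<close>; accordingly, so does
  the matrix \<open>metric_matrix\<close> below.\<close>

type_synonym ('e, 'b) path_frames = "real set \<Rightarrow> (real \<Rightarrow> 'b) \<Rightarrow> real \<Rightarrow> nat \<Rightarrow> 'e"

definition bases_along_paths ::
    "'b topology \<Rightarrow> ('b \<Rightarrow> (real, 'e) module) \<Rightarrow> nat \<Rightarrow> ('e, 'b) path_frames \<Rightarrow> bool" where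
  "bases_along_paths B V n e \<longleftrightarrow>
    (\<forall>J \<gamma>. path_in B J \<gamma> \<longrightarrow> (\<forall>s\<in>J. ordered_basis n (V (\<gamma> s)) (e J \<gamma> s)))"

definition transport_matrix ::
    "('b \<Rightarrow> (real, 'e) module) \<Rightarrow> nat \<Rightarrow> ('e, 'b) transport \<Rightarrow> ('e, 'b) path_frames \<Rightarrow>
      real set \<Rightarrow> (real \<Rightarrow> 'b) \<Rightarrow> real \<Rightarrow> real \<Rightarrow> real mat" where
  "transport_matrix V n L e J \<gamma> t s = (THE A. A \<in> carrier_mat n n \<and>
    (\<forall>j<n. L J \<gamma> s t (e J \<gamma> s j) =
      (\<Oplus>\<^bsub>V (\<gamma> t)\<^esub> i\<in>{..<n}. A $$ (i, j) \<odot>\<^bsub>V (\<gamma> t)\<^esub> e J \<gamma> t i)))"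

definition metric_matrix ::
    "nat \<Rightarrow> ('b \<Rightarrow> 'e \<Rightarrow> 'e \<Rightarrow> real) \<Rightarrow> ('e, 'b) path_frames \<Rightarrow>
      real set \<Rightarrow> (real \<Rightarrow> 'b) \<Rightarrow> real \<Rightarrow> real mat" where
  "metric_matrix n g e J \<gamma> s = mat n n (\<lambda>(i, j). g (\<gamma> s) (e J \<gamma> s i) (e J \<gamma> s j))"

end

theory Submission
  imports Defs
begin

text \<open>Bilinear forms on a finite-dimensional space coincide iff they have the same Gram matrix in a
  basis. For fixed \<open>s\<close> and \<open>t\<close>, consistency says that \<open>g\<close> over \<open>\<gamma> s\<close> coincides with the pullback
  of \<open>g\<close> over \<open>\<gamma> t\<close> by the transport from \<open>s\<close> to \<open>t\<close>; the Gram matrix of that pullback is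
  \<open>H\<^sup>T G H\<close>.\<close>

section \<open>Linear and bilinear forms evaluated on finite sums\<close>

definition bilinear_form :: "(real, 'e) module \<Rightarrow> ('e \<Rightarrow> 'e \<Rightarrow> real) \<Rightarrow> bool" where
  "bilinear_form W h \<longleftrightarrow>
    (\<forall>u\<in>carrier W. \<forall>v\<in>carrier W. \<forall>w\<in>carrier W.
      h (u \<oplus>\<^bsub>W\<^esub> v) w = h u w + h v w \<and> h w (u \<oplus>\<^bsub>W\<^esub> v) = h w u + h w v) \<and>
    (\<forall>a. \<forall>u\<in>carrier W. \<forall>v\<in>carrier W.
      h (a \<odot>\<^bsub>W\<^esub> u) v = a * h u v \<and> h u (a \<odot>\<^bsub>W\<^esub> v) = a * h u v)"

text \<open>Linearity enters as two bare equations on the carrier, so that \<open>f\<close> can be a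
  bilinear form with either argument held fixed. Induction on \<open>A\<close> then pulls the sum
  out.\<close>

lemma linear_functional_finsum:
  fixes W :: "(real, 'e) module" and f :: "'e \<Rightarrow> real"
  assumes W: "vectorspace class_ring W"
    and add: "\<And>u v. u \<in> carrier W \<Longrightarrow> v \<in> carrier W \<Longrightarrow> f (u \<oplus>\<^bsub>W\<^esub> v) = f u + f v"
    and smult: "\<And>a u. u \<in> carrier W \<Longrightarrow> f (a \<odot>\<^bsub>W\<^esub> u) = a * f u"
    and "finite A" "\<And>i. i \<in> A \<Longrightarrow> b i \<in> carrier W"
  shows "f (\<Oplus>\<^bsub>W\<^esub> i\<in>A. c i \<odot>\<^bsub>W\<^esub> b i) = (\<Sum>i\<in>A. c i * f (b i))"
proof -
  interpret W: vectorspace class_ring W by (rule W)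
  have cl: "a \<odot>\<^bsub>W\<^esub> u \<in> carrier W" if "u \<in> carrier W" for a u
    using W.smult_closed[of a u] that by simp
  \<comment> \<open>This is the empty sum: additivity at zero plus zero gives
    \<open>f 0 = f 0 + f 0\<close>.\<close>
  have "f \<zero>\<^bsub>W\<^esub> = 0"
    using add[of "\<zero>\<^bsub>W\<^esub>" "\<zero>\<^bsub>W\<^esub>"] by simp
  with assms(4,5) show ?thesis
  proof (induction A)
    case (insert i A)
    have "(\<lambda>i. c i \<odot>\<^bsub>W\<^esub> b i) \<in> A \<rightarrow> carrier W"
      using insert.prems cl by auto
    then have "f (\<Oplus>\<^bsub>W\<^esub> i\<in>insert i A. c i \<odot>\<^bsub>W\<^esub> b i)
        = f (c i \<odot>\<^bsub>W\<^esub> b i) + f (\<Oplus>\<^bsub>W\<^esub> i\<in>A. c i \<odot>\<^bsub>W\<^esub> b i)"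
      using insert.hyps insert.prems cl
      by (simp add: W.finsum_insert add W.finsum_closed)
    then show ?case
      using insert smult by simp
  qed simp
qed

text \<open>Expand the first argument while the second sum is kept as a single vector, then expand
  the second argument against each \<open>b i\<close>.\<close>

lemma bilinear_form_finsum:
  assumes W: "vectorspace class_ring W" and h: "bilinear_form W h"
    and fin: "finite A" "finite A'"
    and b: "\<And>i. i \<in> A \<Longrightarrow> b i \<in> carrier W" and b': "\<And>i. i \<in> A' \<Longrightarrow> b' i \<in> carrier W"
  shows "h (\<Oplus>\<^bsub>W\<^esub> i\<in>A. c i \<odot>\<^bsub>W\<^esub> b i) (\<Oplus>\<^bsub>W\<^esub> j\<in>A'. c' j \<odot>\<^bsub>W\<^esub> b' j)
    = (\<Sum>i\<in>A. \<Sum>j\<in>A'. c i * c' j * h (b i) (b' j))"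
proof -
  interpret W: vectorspace class_ring W by (rule W)
  let ?v = "\<Oplus>\<^bsub>W\<^esub> j\<in>A'. c' j \<odot>\<^bsub>W\<^esub> b' j"
  have "?v \<in> carrier W"
    using b' W.smult_closed by (intro W.finsum_closed) auto
  then have "h (\<Oplus>\<^bsub>W\<^esub> i\<in>A. c i \<odot>\<^bsub>W\<^esub> b i) ?v = (\<Sum>i\<in>A. c i * h (b i) ?v)"
    using h b fin(1) by (intro linear_functional_finsum[OF W]) (auto simp: bilinear_form_def)
  also have "h (b i) ?v = (\<Sum>j\<in>A'. c' j * h (b i) (b' j))" if "i \<in> A" for i
    using h b b' fin(2) that
    by (intro linear_functional_finsum[OF W]) (auto simp: bilinear_form_def)
  then have "(\<Sum>i\<in>A. c i * h (b i) ?v) = (\<Sum>i\<in>A. \<Sum>j\<in>A'. c i * c' j * h (b i) (b' j))"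
    by (simp add: sum_distrib_left mult.assoc)
  finally show ?thesis .
qed

section \<open>Coordinates with respect to an ordered basis\<close>

lemma ordered_basis_closed:
  assumes "vectorspace class_ring W" "ordered_basis n W b" "i < n"
  shows "b i \<in> carrier W"
  using assms by (auto simp: ordered_basis_def vectorspace.basis_def)

text \<open>\<open>basis_criterion\<close> speaks of an unordered basis, so its coefficients are
  functions of basis vectors, extensional in order to be unique as functions. Injectivity of
  \<open>b\<close> turns its sum over vectors into a sum over indices.\<close>

lemma ordered_basis_ex1_lincomb:
  assumes W: "vectorspace class_ring W" and b: "ordered_basis n W b" and u: "u \<in> carrier W"
  shows "\<exists>!a. a \<in> extensional (b ` {..<n}) \<and> (\<Oplus>\<^bsub>W\<^esub> i\<in>{..<n}. a (b i) \<odot>\<^bsub>W\<^esub> b i) = u"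
proof -
  interpret W: vectorspace class_ring W by (rule W)
  let ?A = "b ` {..<n}"
  have inj: "inj_on b {..<n}" and basis: "W.basis ?A"
    using b by (auto simp: ordered_basis_def)
  have A: "finite ?A" "?A \<subseteq> carrier W"
    using basis by (auto simp: W.basis_def)
  have "W.lincomb a ?A = (\<Oplus>\<^bsub>W\<^esub> i\<in>{..<n}. a (b i) \<odot>\<^bsub>W\<^esub> b i)" for a
  proof -
    have "(\<lambda>v. a v \<odot>\<^bsub>W\<^esub> v) \<in> ?A \<rightarrow> carrier W"
      using A W.smult_closed by auto
    from W.finsum_reindex[OF this inj] show ?thesis
      by (simp add: W.lincomb_def)
  qed
  then show ?thesis
    using W.basis_criterion[OF A] basis u by (simp add: PiE_def)
qed

lemma ordered_basis_coords_exist: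
  assumes "vectorspace class_ring W" "ordered_basis n W b" "u \<in> carrier W"
  shows "\<exists>c. u = (\<Oplus>\<^bsub>W\<^esub> i\<in>{..<n}. c i \<odot>\<^bsub>W\<^esub> b i)"
proof -
  obtain a where "(\<Oplus>\<^bsub>W\<^esub> i\<in>{..<n}. a (b i) \<odot>\<^bsub>W\<^esub> b i) = u"
    using ordered_basis_ex1_lincomb[OF assms] by blast
  then show ?thesis
    by (intro exI[of _ "\<lambda>i. a (b i)"]) simp
qed

lemma ordered_basis_coords_unique:
  assumes W: "vectorspace class_ring W" and b: "ordered_basis n W b"
    and eq: "(\<Oplus>\<^bsub>W\<^esub> i\<in>{..<n}. c i \<odot>\<^bsub>W\<^esub> b i) = (\<Oplus>\<^bsub>W\<^esub> i\<in>{..<n}. d i \<odot>\<^bsub>W\<^esub> b i)"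
    and "i < n"
  shows "c i = d i"
proof -
  interpret W: vectorspace class_ring W by (rule W)
  let ?A = "b ` {..<n}" and ?S = "\<lambda>c. \<Oplus>\<^bsub>W\<^esub> i\<in>{..<n}. c i \<odot>\<^bsub>W\<^esub> b i"
  have inj: "inj_on b {..<n}"
    using b by (simp add: ordered_basis_def)
  have cl: "a \<odot>\<^bsub>W\<^esub> b i \<in> carrier W" if "i < n" for a i
    using W.smult_closed[of a "b i"] ordered_basis_closed[OF W b that] by simp
  \<comment> \<open>\<open>F\<close> moves coefficients from indices to basis vectors; restriction
    makes the result extensional. The values of \<open>c\<close> at indices from \<open>n\<close> on
    are forgotten, so \<open>F c = F d\<close> can yield \<open>c i = d i\<close> only for
    \<open>i < n\<close>.\<close>
  define F where "F c = restrict (\<lambda>v. c (the_inv_into {..<n} b v)) ?A" for c :: "nat \<Rightarrow> real"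
  have F: "F c (b i) = c i" if "i < n" for c i
    using that inj by (simp add: F_def the_inv_into_f_f)
  have F_lincomb: "?S (\<lambda>i. F c (b i)) = ?S c" for c
    by (intro W.finsum_cong') (auto simp: F cl)
  let ?P = "\<lambda>a. a \<in> extensional ?A \<and> ?S (\<lambda>i. a (b i)) = ?S c"
  have "?S c \<in> carrier W"
    using cl by (intro W.finsum_closed) auto
  then have "\<exists>!a. ?P a"
    by (rule ordered_basis_ex1_lincomb[OF W b])
  moreover have "?P (F c)" "?P (F d)"
    using F_lincomb[of c] F_lincomb[of d] eq by (simp_all add: F_def)
  ultimately have "F c = F d"
    by blast
  then show ?thesis
    using F[OF \<open>i < n\<close>] by metis
qed

text \<open>Once the coordinates of \<open>u\<close> and \<open>v\<close> are fixed, the value of a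
  form at them is a double sum that depends on the form only through its values on pairs of basis
  vectors.\<close>

lemma bilinear_forms_eq_iff_eq_on_basis:
  assumes W: "vectorspace class_ring W" and b: "ordered_basis n W b"
    and h: "bilinear_form W h" and k: "bilinear_form W k"
  shows "(\<forall>u\<in>carrier W. \<forall>v\<in>carrier W. h u v = k u v) \<longleftrightarrow>
    (\<forall>i<n. \<forall>j<n. h (b i) (b j) = k (b i) (b j))"
proof
  assume eq: "\<forall>i<n. \<forall>j<n. h (b i) (b j) = k (b i) (b j)"
  show "\<forall>u\<in>carrier W. \<forall>v\<in>carrier W. h u v = k u v"
  proof (intro ballI)
    fix u v
    assume "u \<in> carrier W" "v \<in> carrier W"
    then obtain c d where u: "u = (\<Oplus>\<^bsub>W\<^esub> i\<in>{..<n}. c i \<odot>\<^bsub>W\<^esub> b i)"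
      and v: "v = (\<Oplus>\<^bsub>W\<^esub> i\<in>{..<n}. d i \<odot>\<^bsub>W\<^esub> b i)"
      using ordered_basis_coords_exist[OF W b] by meson
    have "f u v = (\<Sum>i<n. \<Sum>j<n. c i * d j * f (b i) (b j))" if "bilinear_form W f" for f
      unfolding u v using ordered_basis_closed[OF W b]
      by (intro bilinear_form_finsum[OF W that]) auto
    from this[OF h] this[OF k] show "h u v = k u v"
      using eq by simp
  qed
qed (use ordered_basis_closed[OF W b] in blast)

section \<open>Pullback of a form and its matrix\<close>

lemma bilinear_form_pullback:
  assumes T: "linear_map class_ring U W T" and h: "bilinear_form W h"
  shows "bilinear_form U (\<lambda>u v. h (T u) (T v))"
proof -
  interpret T: linear_map class_ring U W T by (rule T)
  have "T (a \<odot>\<^bsub>U\<^esub> u) = a \<odot>\<^bsub>W\<^esub> T u" if "u \<in> carrier U" for a u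
    using T.T_smult[of a u] that by simp
  then show ?thesis
    using h by (simp add: bilinear_form_def)
qed

text \<open>\<open>transport_matrix\<close> is a definite description, so its defining property
  becomes available only after existence and uniqueness. Both hold column by column: column
  \<open>j\<close> consists of the coordinates of the image of the \<open>j\<close>-th basis
  vector.\<close>

lemma transport_matrix_expansion:
  assumes W: "vectorspace class_ring (V (\<gamma> t))"
    and b: "ordered_basis n (V (\<gamma> t)) (e J \<gamma> t)"
    and cl: "\<And>j. j < n \<Longrightarrow> L J \<gamma> s t (e J \<gamma> s j) \<in> carrier (V (\<gamma> t))"
  shows "transport_matrix V n L e J \<gamma> t s \<in> carrier_mat n n"
    and "j < n \<Longrightarrow> L J \<gamma> s t (e J \<gamma> s j) =
      (\<Oplus>\<^bsub>V (\<gamma> t)\<^esub> i\<in>{..<n}. transport_matrix V n L e J \<gamma> t s $$ (i, j) \<odot>\<^bsub>V (\<gamma> t)\<^esub> e J \<gamma> t i)"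
proof -
  interpret W: vectorspace class_ring "V (\<gamma> t)" by (rule W)
  have ecl: "a \<odot>\<^bsub>V (\<gamma> t)\<^esub> e J \<gamma> t i \<in> carrier (V (\<gamma> t))" if "i < n" for a i
    using W.smult_closed[of a "e J \<gamma> t i"] ordered_basis_closed[OF W b that] by simp
  let ?S = "\<lambda>c. \<Oplus>\<^bsub>V (\<gamma> t)\<^esub> i\<in>{..<n}. c i \<odot>\<^bsub>V (\<gamma> t)\<^esub> e J \<gamma> t i"
  let ?P = "\<lambda>A. A \<in> carrier_mat n n \<and> (\<forall>j<n. L J \<gamma> s t (e J \<gamma> s j) = ?S (\<lambda>i. A $$ (i, j)))"
  have "\<forall>j\<in>{..<n}. \<exists>c. L J \<gamma> s t (e J \<gamma> s j) = ?S c"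
    using ordered_basis_coords_exist[OF W b cl] by simp
  from bchoice[OF this] obtain c where c: "\<And>j. j < n \<Longrightarrow> L J \<gamma> s t (e J \<gamma> s j) = ?S (c j)"
    by auto
  have "\<exists>!A. ?P A"
  proof (rule ex_ex1I)
    \<comment> \<open>The witness has \<open>c j\<close> as its column \<open>j\<close>, hence the
      swapped indices. Its entries agree with \<open>c\<close> for indices below \<open>n\<close>,
      which covers the range of the sum.\<close>
    have "?S (\<lambda>i. mat n n (\<lambda>(i, j). c j i) $$ (i, j)) = ?S (c j)" if "j < n" for j
      using that by (intro W.finsum_cong') (auto simp: ecl)
    then have "?P (mat n n (\<lambda>(i, j). c j i))"
      using c by simp
    then show "\<exists>A. ?P A" ..
  next
    fix A A'
    assume A: "?P A" and A': "?P A'"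
    show "A = A'"
    proof (rule eq_matI)
      fix i j
      assume "i < dim_row A'" "j < dim_col A'"
      then have "i < n" "j < n"
        using A' by auto
      have "?S (\<lambda>i. A $$ (i, j)) = L J \<gamma> s t (e J \<gamma> s j)"
        using A \<open>j < n\<close> by simp
      also have "\<dots> = ?S (\<lambda>i. A' $$ (i, j))"
        using A' \<open>j < n\<close> by simp
      finally have "?S (\<lambda>i. A $$ (i, j)) = ?S (\<lambda>i. A' $$ (i, j))" .
      from ordered_basis_coords_unique[OF W b this \<open>i < n\<close>]
      show "A $$ (i, j) = A' $$ (i, j)" .
    qed (use A A' in auto)
  qed
  then have "?P (transport_matrix V n L e J \<gamma> t s)"
    unfolding transport_matrix_def by (rule theI')
  then show "transport_matrix V n L e J \<gamma> t s \<in> carrier_mat n n"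
    and "j < n \<Longrightarrow> L J \<gamma> s t (e J \<gamma> s j) =
      (\<Oplus>\<^bsub>V (\<gamma> t)\<^esub> i\<in>{..<n}. transport_matrix V n L e J \<gamma> t s $$ (i, j) \<odot>\<^bsub>V (\<gamma> t)\<^esub> e J \<gamma> t i)"
    by blast+
qed

text \<open>The right-hand side has the shape produced by \<open>bilinear_form_finsum\<close>: the
  form with Gram matrix \<open>G\<close>, evaluated on the vectors whose coordinates are columns
  \<open>i\<close> and \<open>j\<close> of \<open>A\<close>.\<close>

lemma index_transpose_mult_mult_mat:
  fixes A G :: "'a :: comm_semiring_1 mat"
  assumes A: "A \<in> carrier_mat n n" and G: "G \<in> carrier_mat n n" and "i < n" "j < n"
  shows "(transpose_mat A * G * A) $$ (i, j)
    = (\<Sum>k<n. \<Sum>l<n. A $$ (k, i) * A $$ (l, j) * G $$ (k, l))"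
proof -
  have "(transpose_mat A * G * A) $$ (i, j) = (transpose_mat A * (G * A)) $$ (i, j)"
    using A G by (simp add: assoc_mult_mat[of _ n n _ n _ n])
  also have "\<dots> = (\<Sum>k<n. A $$ (k, i) * (\<Sum>l<n. G $$ (k, l) * A $$ (l, j)))"
    using assms by (auto simp: scalar_prod_def lessThan_atLeast0 intro!: sum.cong)
  finally show ?thesis
    by (simp add: sum_distrib_left ac_simps)
qed

section \<open>Consistency along one path and along all paths\<close>

lemma consistent_along_iff_matrix:
  fixes V :: "'b \<Rightarrow> (real, 'e) module"
  assumes E: "real_vector_bundle E \<pi> B V n" and g: "bundle_metric B V g"
    and L: "linear_transport B V L" and e: "bases_along_paths B V n e"
    and path: "path_in B J \<gamma>"
  defines "H \<equiv> transport_matrix V n L e" and "G \<equiv> metric_matrix n g e"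
  shows "consistent_along V g L J \<gamma> \<longleftrightarrow>
    (\<forall>s\<in>J. \<forall>t\<in>J. G J \<gamma> s = transpose_mat (H J \<gamma> t s) * G J \<gamma> t * H J \<gamma> t s)"
proof -
  have top: "\<gamma> s \<in> topspace B" if "s \<in> J" for s
    using path that by (auto simp: path_in_def continuous_map_def)
  have vs: "vectorspace class_ring (V (\<gamma> s))" if "s \<in> J" for s
    using real_vector_bundle.vectorspace_fibre[OF E top[OF that]] .
  have bil: "bilinear_form (V (\<gamma> s)) (g (\<gamma> s))" if "s \<in> J" for s
    using g top[OF that] by (simp add: bundle_metric_def bilinear_form_def)
  have basis: "ordered_basis n (V (\<gamma> s)) (e J \<gamma> s)" if "s \<in> J" for s
    using e path that by (simp add: bases_along_paths_def)
  have lin: "linear_map class_ring (V (\<gamma> s)) (V (\<gamma> t)) (L J \<gamma> s t)" if "s \<in> J" "t \<in> J" for s t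
    using L path that by (simp add: linear_transport_def)
  \<comment> \<open>Both sides of the goal quantify over the same \<open>s\<close> and
    \<open>t\<close>, so it is enough to prove the equivalence for each fixed pair.\<close>
  have "(\<forall>u\<in>carrier (V (\<gamma> s)). \<forall>v\<in>carrier (V (\<gamma> s)).
        g (\<gamma> s) u v = g (\<gamma> t) (L J \<gamma> s t u) (L J \<gamma> s t v)) \<longleftrightarrow>
      G J \<gamma> s = transpose_mat (H J \<gamma> t s) * G J \<gamma> t * H J \<gamma> t s" (is "?C \<longleftrightarrow> _ = ?M")
    if s: "s \<in> J" and t: "t \<in> J" for s t
  proof -
    interpret T: linear_map class_ring "V (\<gamma> s)" "V (\<gamma> t)" "L J \<gamma> s t"
      by (rule lin[OF s t])
    have cl: "L J \<gamma> s t (e J \<gamma> s j) \<in> carrier (V (\<gamma> t))" if "j < n" for j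
      using T.T_im ordered_basis_closed[OF vs[OF s] basis[OF s] that] by blast
    note exp = transport_matrix_expansion[where s = s and t = t and \<gamma> = \<gamma> and V = V and L = L
          and J = J and e = e,
        OF vs[OF t] basis[OF t], folded H_def]
    have H: "H J \<gamma> t s \<in> carrier_mat n n"
      by (rule exp(1)) (rule cl)
    have expand: "L J \<gamma> s t (e J \<gamma> s j) =
        (\<Oplus>\<^bsub>V (\<gamma> t)\<^esub> i\<in>{..<n}. H J \<gamma> t s $$ (i, j) \<odot>\<^bsub>V (\<gamma> t)\<^esub> e J \<gamma> t i)"
      if "j < n" for j
      by (rule exp(2)) (use cl that in auto)
    have G: "G J \<gamma> r \<in> carrier_mat n n" for r
      by (simp add: G_def metric_matrix_def)
    \<comment> \<open>\<open>?M\<close> is the Gram matrix of the pulled-back metric, since columns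
      \<open>i\<close> and \<open>j\<close> of \<open>H J \<gamma> t s\<close> are the coordinates
      of the two transported basis vectors.\<close>
    have Gram: "g (\<gamma> t) (L J \<gamma> s t (e J \<gamma> s i)) (L J \<gamma> s t (e J \<gamma> s j)) = ?M $$ (i, j)"
      if "i < n" "j < n" for i j
    proof -
      have "g (\<gamma> t) (L J \<gamma> s t (e J \<gamma> s i)) (L J \<gamma> s t (e J \<gamma> s j))
          = (\<Sum>k<n. \<Sum>l<n. H J \<gamma> t s $$ (k, i) * H J \<gamma> t s $$ (l, j)
              * g (\<gamma> t) (e J \<gamma> t k) (e J \<gamma> t l))"
        unfolding expand[OF that(1)] expand[OF that(2)]
        using ordered_basis_closed[OF vs[OF t] basis[OF t]]
        by (intro bilinear_form_finsum[OF vs[OF t] bil[OF t]]) auto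
      also have "\<dots> = ?M $$ (i, j)"
        unfolding index_transpose_mult_mult_mat[OF H G that]
        by (simp add: G_def metric_matrix_def)
      finally show ?thesis .
    qed
    \<comment> \<open>\<open>?C\<close> says that the metric over \<open>\<gamma> s\<close> equals
      the pullback of the metric over \<open>\<gamma> t\<close>; the basis at \<open>s\<close> tests
      this equality.\<close>
    have "?C \<longleftrightarrow> (\<forall>i<n. \<forall>j<n. g (\<gamma> s) (e J \<gamma> s i) (e J \<gamma> s j)
        = g (\<gamma> t) (L J \<gamma> s t (e J \<gamma> s i)) (L J \<gamma> s t (e J \<gamma> s j)))"
      using bilinear_forms_eq_iff_eq_on_basis[OF vs[OF s] basis[OF s] bil[OF s]
        bilinear_form_pullback[OF lin[OF s t] bil[OF t]]] .
    also have "\<dots> \<longleftrightarrow> (\<forall>i<n. \<forall>j<n. G J \<gamma> s $$ (i, j) = ?M $$ (i, j))"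
      using Gram by (simp add: G_def metric_matrix_def)
    also have "\<dots> \<longleftrightarrow> G J \<gamma> s = ?M"
      using G[of s] H by (auto intro!: eq_matI)
    finally show ?thesis .
  qed
  then show ?thesis
    unfolding consistent_along_def by blast
qed

theorem proposition2p1:
  fixes E :: "'e topology" and \<pi> :: "'e \<Rightarrow> 'b" and B :: "'b topology"
    and V :: "'b \<Rightarrow> (real, 'e) module" and n :: nat
    and g :: "'b \<Rightarrow> 'e \<Rightarrow> 'e \<Rightarrow> real"
    and L :: "('e, 'b) transport" and e :: "('e, 'b) path_frames"
  assumes "real_vector_bundle E \<pi> B V n"
    and "bundle_metric B V g"
    and "linear_transport B V L"
    and "bases_along_paths B V n e"
  defines "H \<equiv> transport_matrix V n L e" and "G \<equiv> metric_matrix n g e"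
  shows "(consistent B V g L \<longleftrightarrow>
           (\<forall>J \<gamma>. path_in B J \<gamma> \<longrightarrow> (\<forall>s\<in>J. \<forall>t\<in>J.
             G J \<gamma> s = transpose_mat (H J \<gamma> t s) * G J \<gamma> t * H J \<gamma> t s))) \<and>
         (\<forall>J \<gamma>. path_in B J \<gamma> \<longrightarrow>
           (consistent_along V g L J \<gamma> \<longleftrightarrow> (\<forall>s\<in>J. \<forall>t\<in>J.
             G J \<gamma> s = transpose_mat (H J \<gamma> t s) * G J \<gamma> t * H J \<gamma> t s)))"
proof -
  have along: "consistent_along V g L J \<gamma> \<longleftrightarrow> (\<forall>s\<in>J. \<forall>t\<in>J.
      G J \<gamma> s = transpose_mat (H J \<gamma> t s) * G J \<gamma> t * H J \<gamma> t s)"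
    if "path_in B J \<gamma>" for J \<gamma>
    unfolding H_def G_def by (rule consistent_along_iff_matrix[OF assms(1-4) that])
  show ?thesis
    \<comment> \<open>The global claim is the pathwise one quantified over all paths;
      \<open>imp_cong\<close> supplies \<open>path_in B J \<gamma>\<close> as the premise of
      \<open>along\<close> under the implication.\<close>
    by (simp add: consistent_def along cong: imp_cong)
qed

end
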